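(* Let $\epsilon\in(0,1)$ be such that $1/\epsilon$ is an integer, let $\mathcal{N}=\{1,\dots,n\}$ be a universe of products with preference weights $v_1\ge\cdots\ge v_n>0$, and let $T\ge 1$ be the number of customers. Let $S^*$ be an optimal assortment, i.e. $\mathbb{E}(M(S^* ))=\max_{S'\subseteq\mathcal{N}}\mathbb{E}(M(S'))$. Then there exists a block-based assortment $S\subseteq\mathcal{N}$ for which $\mathbb{E}(M(S))\ge(1-\epsilon)\cdot\mathbb{E}(M(S^* ))$.
   Context: Multinomial Logit (MNL) model: each product $i\in\mathcal{N}$ has preference weight $v_i>0$ and the no-purchase option $0$ has weight $1$. For an assortment $S\subseteq\mathcal{N}$ let $v(S)=\sum_{i\in S}v_i$, $\phi_i(S)=\frac{v_i}{1+v(S)}$ for $i\in S$, and $\phi_0(S)=\frac{1}{1+v(S)}$. When $S$ is offered to $T$ customers, each customer independently chooses option $i\in S\cup\{0\}$ with probability $\phi_i(S)$. The load $L_i(S)$ is the (random) number of customers choosing product $i$, and $M(S)=\max_{i\in S}L_i(S)$ (with $M(\emptyset)=0$). Block-based assortments (for $\epsilon\in(0,1)$ with $1/\epsilon$ an integer, products indexed so that $v_1\ge\cdots\ge v_n$): an assortment $S\subseteq\mathcal{N}$ is block-based if either $|S|\le1/\epsilon$, or $S=S_1\cup S_2\cup S_3$ where: (1) $S_1\subseteq\mathcal{N}$ is an arbitrary set of exactly $1/\epsilon$ products; let $a$ be the highest index in $S_1$. (2) $S_2=\{a+1,a+2,\dots,b\}$ for some $a\le b\le n$ (so $S_2=\emptyset$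 if $b=a$). (3) If $b=n$ then $S_3=\emptyset$. Otherwise put $c=b+1$ and partition the products whose weight lies in $[\epsilon v_c,v_c]$ into classes $C_1,\dots,C_L$, where $L$ is the least integer with $(1-\epsilon)^L\le\epsilon$: $C_1$ consists of all products with weight in $[(1-\epsilon)v_c,v_c]$; for $\ell\ge2$, $C_\ell$ consists of all products with weight in $[(1-\epsilon)^\ell v_c,(1-\epsilon)^{\ell-1}v_c)$, with the lower endpoint of the last class truncated at $\epsilon v_c$. For each $\ell$ an integer $0\le N_\ell\le|C_\ell|$ is chosen, and $S_3$ is the union over $\ell$ of the sets consisting of the $N_\ell$ products of $C_\ell$ with the largest indices. *)

theory Defs
  imports "HOL-Probability.Probability"
begin

text \<open>
  The universe is \<^term>\<open>{1..n::nat}\<close>; \<^term>\<open>v i\<close> is the preference weight of product \<^term>\<open>i\<close>, and the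
  index 0 is the no-purchase alternative, whose weight is 1.
\<close>

definition mnl_prob :: "(nat \<Rightarrow> real) \<Rightarrow> nat set \<Rightarrow> nat \<Rightarrow> real" where
  "mnl_prob v S i =
     (if i = 0 then 1 / (1 + (\<Sum>j\<in>S. v j))
      else if i \<in> S then v i / (1 + (\<Sum>j\<in>S. v j))
      else 0)"

definition mnl_choice :: "(nat \<Rightarrow> real) \<Rightarrow> nat set \<Rightarrow> nat pmf" where
  "mnl_choice v S = embed_pmf (mnl_prob v S)"

text \<open>
  The use of \<^const>\<open>embed_pmf\<close> is justified on every assortment of products with positive weights.
\<close>

lemma pmf_mnl_choice:
  assumes "S \<subseteq> {1..n}" and "\<And>i. i \<in> {1..n} \<Longrightarrow> 0 < v i"
  shows "pmf (mnl_choice v S) i = mnl_prob v S i"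
proof -
  have fin: "finite S" and S0: "0 \<notin> S"
    using assms(1) finite_subset by auto
  have vS: "0 \<le> v j" if "j \<in> S" for j
    using assms that by (meson less_imp_le subsetD)
  then have pos: "0 < 1 + (\<Sum>j\<in>S. v j)"
    by (intro add_pos_nonneg sum_nonneg) auto
  have nn: "0 \<le> mnl_prob v S x" for x
    using pos vS by (simp add: mnl_prob_def)
  have "(\<integral>\<^sup>+ x. ennreal (mnl_prob v S x) \<partial>count_space UNIV) =
        (\<Sum>x\<in>insert 0 S. ennreal (mnl_prob v S x))"
    using fin by (intro nn_integral_count_space') (auto simp: mnl_prob_def)
  also have "\<dots> = ennreal (\<Sum>x\<in>insert 0 S. mnl_prob v S x)"
    using nn by (intro sum_ennreal) auto
  also have "(\<Sum>x\<in>insert 0 S. mnl_prob v S x) =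
      1 / (1 + (\<Sum>j\<in>S. v j)) + (\<Sum>x\<in>S. v x / (1 + (\<Sum>j\<in>S. v j)))"
    using fin S0 by (auto simp: mnl_prob_def intro!: sum.cong)
  also have "\<dots> = 1"
    using pos by (simp add: sum_divide_distrib [symmetric] add_divide_distrib [symmetric])
  finally show ?thesis
    unfolding mnl_choice_def using nn by (intro pmf_embed_pmf) auto
qed

text \<open>Independent choices of the customers \<^term>\<open>{..<T::nat}\<close>.\<close>

definition customer_choices :: "(nat \<Rightarrow> real) \<Rightarrow> nat \<Rightarrow> nat set \<Rightarrow> (nat \<Rightarrow> nat) pmf" where
  "customer_choices v T S = Pi_pmf {..<T} 0 (\<lambda>_. mnl_choice v S)"

definition load :: "nat \<Rightarrow> (nat \<Rightarrow> nat) \<Rightarrow> nat \<Rightarrow> nat" where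
  "load T \<omega> i = card {t \<in> {..<T}. \<omega> t = i}"

definition max_load :: "nat \<Rightarrow> nat set \<Rightarrow> (nat \<Rightarrow> nat) \<Rightarrow> nat" where
  "max_load T S \<omega> = (if S = {} then 0 else Max (load T \<omega> ` S))"

definition expected_max_load :: "(nat \<Rightarrow> real) \<Rightarrow> nat \<Rightarrow> nat set \<Rightarrow> real" where
  "expected_max_load v T S =
     measure_pmf.expectation (customer_choices v T S) (\<lambda>\<omega>. real (max_load T S \<omega>))"

definition num_classes :: "real \<Rightarrow> nat" where
  "num_classes \<epsilon> = (LEAST L. (1 - \<epsilon>) ^ L \<le> \<epsilon>)"

text \<open>
  The classes range over the whole universe, so if weights coincide then \<^term>\<open>weight_class \<epsilon> n v c 1\<close>
  may contain products of index smaller than \<^term>\<open>c\<close>.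
\<close>

definition weight_class :: "real \<Rightarrow> nat \<Rightarrow> (nat \<Rightarrow> real) \<Rightarrow> nat \<Rightarrow> nat \<Rightarrow> nat set" where
  "weight_class \<epsilon> n v c l =
     {i \<in> {1..n}.
        (if l = num_classes \<epsilon> then \<epsilon> else (1 - \<epsilon>) ^ l) * v c \<le> v i \<and>
        (if l = 1 then v i \<le> v c else v i < (1 - \<epsilon>) ^ (l - 1) * v c)}"

text \<open>The \<^term>\<open>N\<close> largest elements of \<^term>\<open>C\<close> (for finite \<^term>\<open>C\<close> and \<^term>\<open>N \<le> card C\<close>).\<close>

definition largest :: "nat \<Rightarrow> nat set \<Rightarrow> nat set" where
  "largest N C = {i \<in> C. card {j \<in> C. i < j} < N}"

definition block_based :: "real \<Rightarrow> nat \<Rightarrow> (nat \<Rightarrow> real) \<Rightarrow> nat set \<Rightarrow> bool" where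
  "block_based \<epsilon> n v S \<longleftrightarrow> S \<subseteq> {1..n} \<and>
     (real (card S) \<le> 1 / \<epsilon> \<or>
      (\<exists>S1 S2 S3 a b.
         S = S1 \<union> S2 \<union> S3 \<and>
         S1 \<subseteq> {1..n} \<and> real (card S1) = 1 / \<epsilon> \<and> a = Max S1 \<and>
         a \<le> b \<and> b \<le> n \<and> S2 = {a+1..b} \<and>
         (if b = n then S3 = {}
          else \<exists>N. (\<forall>l\<in>{1..num_classes \<epsilon>}. N l \<le> card (weight_class \<epsilon> n v (b + 1) l)) \<and>
                   S3 = (\<Union>l\<in>{1..num_classes \<epsilon>}. largest (N l) (weight_class \<epsilon> n v (b + 1) l)))))"

end

theory Submission
  imports Defs
begin

text \<open>
  Fix the total weight of an assortment, and with it the probability of no purchase. The expected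
  maximum load is then a Schur-convex function of the purchase probabilities: moving probability
  from one product to another cannot decrease it if the receiving product ends up at least as
  popular as either of the two was before. This is the effect behind the theorem.

  Let \<open>k = 1/\<epsilon>\<close>, let \<open>R\<close> be an assortment with more than \<open>k\<close> products, let \<open>S1\<close> be its \<open>k\<close> products
  of smallest index, and let \<open>a\<close> be the largest index in \<open>S1\<close>. All other products of \<open>R\<close> have index
  above \<open>a\<close>. Pour their weight towards \<open>a + 1\<close>, filling up the products \<open>a + 1, a + 2, \<dots>\<close> in turn,
  each to its full weight (lemma \<open>expect_le_pour\<close>). As the weights decrease with the index, every
  transfer is of the favourable kind. At the end the products \<open>a + 1, \<dots>, d - 1\<close> are full, the product
  \<open>d\<close> holds at most its own weight, and the products behind \<open>d\<close> hold nothing.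

  It remains to remove the partially filled product \<open>d\<close>, which turns the weights into those of the
  genuine assortment \<open>S = S1 \<union> {a + 1, \<dots>, d - 1}\<close>. Removing \<open>d\<close> makes every other option more likely,
  and since \<open>d\<close> is no more popular than any of the \<open>k\<close> products of \<open>S1\<close>, the expected maximum load of
  \<open>S\<close> is at least what is left of the old one when instead any single product of \<open>S1 \<union> {d}\<close> is
  ignored. In each outcome, ignoring a single product lowers the maximum for at most one of these
  \<open>k + 1\<close> choices, so averaging over them gives the factor \<open>k / (k + 1) \<ge> 1 - \<epsilon>\<close>
  (lemma \<open>ex_prefix_assortment\<close>). The assortment \<open>S\<close> is block-based, with every \<open>N\<^sub>\<ell>\<close> equal to \<open>0\<close>.

  The comparisons of multinomial distributions are carried out by induction on the number of
  customers, for expectations written as iterates of a positive linear operator.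
\<close>

section \<open>Expectations as iterated operators\<close>

definition bump :: "(nat \<Rightarrow> nat) \<Rightarrow> nat \<Rightarrow> nat \<Rightarrow> nat" where
  "bump x i = x(i := Suc (x i))"

text \<open>
  Loads are vectors counting the customers of each option. If \<open>p\<close> is a probability
  distribution on \<open>J\<close>, the value at \<open>x\<close> is the expectation of the function \<open>g\<close> of the loads after one
  more customer has arrived at the loads \<open>x\<close>. Allowing arbitrary \<open>p\<close> and \<open>g\<close> makes the operator
  linear in both.
\<close>
definition next_customer ::
    "nat set \<Rightarrow> (nat \<Rightarrow> real) \<Rightarrow> ((nat \<Rightarrow> nat) \<Rightarrow> real) \<Rightarrow> (nat \<Rightarrow> nat) \<Rightarrow> real" where
  "next_customer J p g x = (\<Sum>i\<in>J. p i * g (bump x i))"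

text \<open>The unqualified name of a transposition refers to the transpose of a matrix.\<close>
abbreviation exchange :: "nat \<Rightarrow> nat \<Rightarrow> nat \<Rightarrow> nat" where
  "exchange \<equiv> Transposition.transpose"

primrec expect ::
    "nat set \<Rightarrow> (nat \<Rightarrow> real) \<Rightarrow> nat \<Rightarrow> ((nat \<Rightarrow> nat) \<Rightarrow> real) \<Rightarrow> (nat \<Rightarrow> nat) \<Rightarrow> real" where
  "expect J p 0 g = g"
| "expect J p (Suc T) g = next_customer J p (expect J p T g)"

lemma bump_commute: "bump (bump x i) j = bump (bump x j) i"
  by (auto simp: bump_def fun_eq_iff)

lemma expect_Suc_inner: "expect J p (Suc T) g = expect J p T (next_customer J p g)"
  by (induction T) simp_all

text \<open>
  The loads do not record the order of arrival, so customers with different choice probabilities may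
  be interchanged.
\<close>
lemma next_customer_commute:
  "next_customer J p (next_customer J q g) = next_customer J q (next_customer J p g)"
proof
  fix x
  have "next_customer J p (next_customer J q g) x
      = (\<Sum>i\<in>J. \<Sum>j\<in>J. p i * q j * g (bump (bump x i) j))"
    by (simp add: next_customer_def sum_distrib_left mult.assoc)
  also have "\<dots> = (\<Sum>j\<in>J. \<Sum>i\<in>J. p i * q j * g (bump (bump x i) j))"
    by (rule sum.swap)
  also have "\<dots> = next_customer J q (next_customer J p g) x"
    by (simp add: next_customer_def sum_distrib_left mult_ac bump_commute)
  finally show "next_customer J p (next_customer J q g) x
      = next_customer J q (next_customer J p g) x" .
qed

lemma expect_next_customer_commute:
  "expect J p T (next_customer J q g) = next_customer J q (expect J p T g)"
  by (induction T) (simp_all add: next_customer_commute)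

lemma expect_add:
  "expect J p T (\<lambda>x. g x + h x) = (\<lambda>x. expect J p T g x + expect J p T h x)"
  by (induction T) (simp_all add: next_customer_def distrib_left sum.distrib)

lemma expect_scale: "expect J p T (\<lambda>x. c * g x) = (\<lambda>x. c * expect J p T g x)"
  by (induction T) (simp_all add: next_customer_def sum_distrib_left mult_ac)

lemma expect_sum:
  assumes "finite K"
  shows "expect J p T (\<lambda>x. \<Sum>j\<in>K. g j x) = (\<lambda>x. \<Sum>j\<in>K. expect J p T (g j) x)"
  using assms
proof induction
  case empty
  then show ?case using expect_scale[of J p T 0 "\<lambda>_. 0"] by simp
next
  case (insert j K)
  then show ?case by (simp add: expect_add)
qed

lemma next_customer_mono:
  assumes "\<And>i. i \<in> J \<Longrightarrow> 0 \<le> p i" and "\<And>x. g x \<le> h x"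
  shows "next_customer J p g x \<le> next_customer J p h x"
  unfolding next_customer_def using assms by (intro sum_mono mult_left_mono) auto

lemma expect_mono:
  assumes "\<And>i. i \<in> J \<Longrightarrow> 0 \<le> p i" and "\<And>x. g x \<le> h x"
  shows "expect J p T g x \<le> expect J p T h x"
  using assms by (induction T arbitrary: x) (auto intro: next_customer_mono)

text \<open>Renaming the options in the probabilities amounts to renaming them in the loads.\<close>
lemma expect_transpose:
  assumes "i \<in> J" and "j \<in> J"
  defines "\<tau> \<equiv> exchange i j"
  shows "expect J (p \<circ> \<tau>) T g x = expect J p T (\<lambda>y. g (y \<circ> \<tau>)) (x \<circ> \<tau>)"
proof -
  have bij: "bij_betw \<tau> J J"
    unfolding \<tau>_def using assms(1,2) by (simp add: bij_betw_transpose_iff)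
  have invol: "\<tau> (\<tau> k) = k" for k
    by (simp add: \<tau>_def)
  have bump_\<tau>: "bump x (\<tau> k) = bump (x \<circ> \<tau>) k \<circ> \<tau>" for x k
    using invol by (auto simp: bump_def fun_eq_iff)
  have step: "next_customer J (p \<circ> \<tau>) h x = next_customer J p (\<lambda>y. h (y \<circ> \<tau>)) (x \<circ> \<tau>)"
    for h x
  proof -
    have "next_customer J (p \<circ> \<tau>) h x = (\<Sum>k\<in>J. p (\<tau> (\<tau> k)) * h (bump x (\<tau> k)))"
      unfolding next_customer_def by (subst sum.reindex_bij_betw[OF bij, symmetric]) simp
    then show ?thesis
      by (simp add: next_customer_def invol bump_\<tau>)
  qed
  have invol_o: "y \<circ> \<tau> \<circ> \<tau> = y" for y :: "nat \<Rightarrow> nat"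
    by (auto simp: fun_eq_iff invol)
  show ?thesis
    by (induction T arbitrary: x)
      (simp_all add: step invol_o)
qed

text \<open>
  Only loads without customers at options of probability zero can be reached from loads of this kind.
\<close>
lemma expect_cong_support:
  assumes "\<And>i. i \<in> J \<Longrightarrow> i \<notin> K \<Longrightarrow> p i = 0"
    and "\<And>x. (\<And>i. i \<notin> K \<Longrightarrow> x i = 0) \<Longrightarrow> g x = h x"
    and "\<And>i. i \<notin> K \<Longrightarrow> x i = 0"
  shows "expect J p T g x = expect J p T h x"
  using assms(3)
proof (induction T arbitrary: x)
  case 0
  then show ?case using assms(2) by simp
next
  case (Suc T)
  have "p i * expect J p T g (bump x i) = p i * expect J p T h (bump x i)" if "i \<in> J" for i
  proof (cases "i \<in> K")
    case True
    then have "expect J p T g (bump x i) = expect J p T h (bump x i)"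
      using Suc.prems by (intro Suc.IH) (auto simp: bump_def)
    then show ?thesis by simp
  qed (use assms(1) that in simp)
  then show ?case
    unfolding expect.simps next_customer_def by (intro sum.cong refl)
qed

text \<open>
  Conditioning on the choice of the last customer turns \<open>g\<close> into \<open>next_customer J (pmf P) g\<close>,
  a function of the loads of the others.
\<close>
lemma expectation_load_eq_expect:
  assumes "finite J" and "set_pmf P \<subseteq> J"
  shows "measure_pmf.expectation (Pi_pmf {..<T} 0 (\<lambda>_. P)) (\<lambda>w. g (load T w))
       = expect J (pmf P) T g (\<lambda>_. 0)"
proof (induction T arbitrary: g)
  case 0
  have "load 0 w = (\<lambda>_. 0)" for w
    by (auto simp: load_def)
  then show ?case by simp
next
  case (Suc T)
  let ?E = "measure_pmf.expectation (Pi_pmf {..<T} 0 (\<lambda>_. P))"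
  have finP: "finite (set_pmf P)"
    using assms finite_subset by blast
  have fin: "finite (set_pmf (Pi_pmf {..<T} 0 (\<lambda>_. P)))"
    using finP by (subst set_Pi_pmf) (auto intro!: finite_PiE_dflt)
  have load_Suc: "load (Suc T) (w(T := i)) = bump (load T w) i" for w i
  proof
    fix j
    have "{t \<in> {..<Suc T}. (w(T := i)) t = j}
        = (if i = j then insert T else id) {t \<in> {..<T}. w t = j}"
      by auto
    then show "load (Suc T) (w(T := i)) j = bump (load T w) i j"
      by (auto simp: load_def bump_def)
  qed
  have "measure_pmf.expectation (Pi_pmf {..<Suc T} 0 (\<lambda>_. P)) (\<lambda>w. g (load (Suc T) w))
      = measure_pmf.expectation (bind_pmf P (\<lambda>i. map_pmf (\<lambda>w. w(T := i)) (Pi_pmf {..<T} 0 (\<lambda>_. P))))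
          (\<lambda>w. g (load (Suc T) w))"
    by (simp add: lessThan_Suc Pi_pmf_insert' map_pmf_def)
  also have "\<dots> = (\<Sum>i\<in>J. pmf P i *\<^sub>R ?E (\<lambda>w. g (bump (load T w) i)))"
    using assms fin finP by (subst pmf_expectation_bind[where A = J]) (auto simp: load_Suc)
  also have "\<dots> = ?E (\<lambda>w. next_customer J (pmf P) g (load T w))"
    using fin by (simp add: next_customer_def integrable_measure_pmf_finite)
  also have "\<dots> = expect J (pmf P) (Suc T) g (\<lambda>_. 0)"
    by (simp only: Suc.IH expect_Suc_inner)
  finally show ?case .
qed

section \<open>Moving probability towards a favourable product\<close>

text \<open>
  If a customer at \<open>d\<close> never helps \<open>g\<close> more than a customer anywhere else, then probability taken from
  \<open>d\<close> is better spent on the other options. The property of \<open>g\<close> is inherited by the expectation after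
  one more customer, which makes the induction work.
\<close>
lemma expect_le_shift_from:
  assumes p: "\<And>i. i \<in> J \<Longrightarrow> 0 \<le> p i" and q: "\<And>i. i \<in> J \<Longrightarrow> 0 \<le> q i"
    and total: "sum p J = sum q J"
    and le: "\<And>i. i \<in> J \<Longrightarrow> i \<noteq> d \<Longrightarrow> p i \<le> q i"
    and worst: "\<And>i x. i \<in> J \<Longrightarrow> g (bump x d) \<le> g (bump x i)"
  shows "expect J p T g x \<le> expect J q T g x"
  using worst
proof (induction T arbitrary: x g)
  case 0
  then show ?case by simp
next
  case (Suc T)
  \<comment> \<open>As the totals agree, subtracting the constant \<open>g (bump y d)\<close> leaves the difference unchanged.\<close>
  have one: "next_customer J p g y \<le> next_customer J q g y" for y
  proof -
    have "0 \<le> (\<Sum>i\<in>J. (q i - p i) * (g (bump y i) - g (bump y d)))"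
      using le Suc.prems by (intro sum_nonneg) (metis diff_ge_0_iff_ge diff_self
          mult_nonneg_nonneg mult_zero_right order_refl)
    also have "\<dots> = (\<Sum>i\<in>J. q i * g (bump y i)) - (\<Sum>i\<in>J. p i * g (bump y i))
        - (sum q J - sum p J) * g (bump y d)"
      by (simp add: sum_distrib_right sum_subtractf sum.distrib left_diff_distrib
          right_diff_distrib)
    finally show ?thesis
      using total by (simp add: next_customer_def)
  qed
  have "expect J p (Suc T) g x \<le> expect J p T (next_customer J q g) x"
    unfolding expect_Suc_inner using p one by (rule expect_mono)
  also have "\<dots> \<le> expect J q T (next_customer J q g) x"
  proof (rule Suc.IH)
    fix i x assume "i \<in> J"
    then show "next_customer J q g (bump x d) \<le> next_customer J q g (bump x i)"
      unfolding next_customer_def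
      using q Suc.prems by (intro sum_mono mult_left_mono) (simp_all add: bump_commute[of x])
  qed
  finally show ?case by (simp only: expect_Suc_inner)
qed

section \<open>Schur convexity of multinomial expectations\<close>

text \<open>
  The slopes of a convex sequence increase, so once it exceeds its initial value it can never return
  to it.
\<close>
lemma convex_sequence_le_endpoint:
  fixes a :: "nat \<Rightarrow> real"
  assumes convex: "\<And>m. m + 2 \<le> T \<Longrightarrow> 2 * a (m + 1) \<le> a m + a (m + 2)"
    and "a T = a 0" and "m \<le> T"
  shows "a m \<le> a 0"
proof (rule ccontr)
  assume "\<not> a m \<le> a 0"
  have slope: "a m - a 0 \<le> real m * (a (m + 1) - a m)" if "m + 1 \<le> T" for m
    using that
  proof (induction m)
    case 0
    then show ?case by simp
  next
    case (Suc m)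
    have "a (Suc m) - a 0 \<le> real (Suc m) * (a (m + 1) - a m)"
      using Suc by (simp add: algebra_simps)
    also have "\<dots> \<le> real (Suc m) * (a (Suc m + 1) - a (Suc m))"
      using convex[of m] Suc.prems by (intro mult_left_mono) auto
    finally show ?case .
  qed
  have "a 0 < a T"
    using \<open>m \<le> T\<close>
  proof (induction rule: dec_induct)
    case base
    then show ?case using \<open>\<not> a m \<le> a 0\<close> by simp
  next
    case (step l)
    then have "0 < real l * (a (l + 1) - a l)"
      using slope[of l] by simp
    then show ?case using step by (simp add: zero_less_mult_iff)
  qed
  then show False using \<open>a T = a 0\<close> by simp
qed

text \<open>
  This is what reduces second differences in the probabilities to second differences in the loads.
\<close>
lemma next_customer_diff_transpose:
  assumes "finite J" and "i \<in> J" and "j \<in> J" and "i \<noteq> j"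
  shows "next_customer J p g x - next_customer J (p \<circ> exchange i j) g x
       = (p i - p j) * (g (bump x i) - g (bump x j))"
proof -
  have "next_customer J p g x - next_customer J (p \<circ> exchange i j) g x
      = (\<Sum>k\<in>J. (p k - p (exchange i j k)) * g (bump x k))"
    by (simp add: next_customer_def sum_subtractf algebra_simps)
  also have "\<dots> = (\<Sum>k\<in>{i, j}. (p k - p (exchange i j k)) * g (bump x k))"
    using assms by (intro sum.mono_neutral_right) (auto simp: Transposition.transpose_def)
  also have "\<dots> = (p i - p j) * (g (bump x i) - g (bump x j))"
    using assms by (simp add: algebra_simps)
  finally show ?thesis .
qed

text \<open>Convexity refers to the direction in which customers are moved between \<open>i\<close> and \<open>j\<close>.\<close>
definition symmetric_convex_in :: "nat \<Rightarrow> nat \<Rightarrow> ((nat \<Rightarrow> nat) \<Rightarrow> real) \<Rightarrow> bool" where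
  "symmetric_convex_in i j g \<longleftrightarrow> (\<forall>x. g (x \<circ> exchange i j) = g x) \<and>
     (\<forall>x. 2 * g (bump (bump x i) j) \<le> g (bump (bump x i) i) + g (bump (bump x j) j))"

text \<open>
  Let \<open>r\<close> of the customers confuse \<open>i\<close> with \<open>j\<close>. As a function of \<open>r\<close> the expectation is a convex
  sequence, because replacing two customers one after the other produces the second difference of
  \<open>g\<close> multiplied by \<open>(p i - p j)\<^sup>2\<close>. If all customers are confused, symmetry of \<open>g\<close> makes the
  expectation the same as if none is, so the values between are not larger.
\<close>
lemma expect_some_transposed_le:
  assumes J: "finite J" "i \<in> J" "j \<in> J" "i \<noteq> j"
    and p: "\<And>k. k \<in> J \<Longrightarrow> 0 \<le> p k"
    and g: "symmetric_convex_in i j g"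
  shows "expect J p s (expect J (p \<circ> exchange i j) r g) (\<lambda>_. 0) \<le> expect J p (s + r) g (\<lambda>_. 0)"
proof -
  let ?p' = "p \<circ> exchange i j"
  let ?A = "next_customer J p" and ?B = "next_customer J ?p'"
  have p': "0 \<le> ?p' k" if "k \<in> J" for k
    using p J that by (auto simp: Transposition.transpose_def)
  define a where "a m = expect J p (s + r - m) (expect J ?p' m g) (\<lambda>_. 0)" for m
  note diff = next_customer_diff_transpose[OF J, of p]
  have second_difference: "2 * ?A (?B g) x \<le> ?A (?A g) x + ?B (?B g) x" for x
  proof -
    have "?A (?A g) x + ?B (?B g) x - 2 * ?A (?B g) x
        = (?A (?A g) x - ?B (?A g) x) - (?A (?B g) x - ?B (?B g) x)"
      by (simp add: next_customer_commute[of J ?p' p g])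
    also have "\<dots> = (p i - p j) * ((?A g (bump x i) - ?B g (bump x i))
        - (?A g (bump x j) - ?B g (bump x j)))"
      by (simp only: diff[of "?A g"] diff[of "?B g"]) (simp add: algebra_simps)
    also have "\<dots> = (p i - p j)\<^sup>2 * (g (bump (bump x i) i) + g (bump (bump x j) j)
        - 2 * g (bump (bump x i) j))"
      unfolding diff by (simp add: algebra_simps power2_eq_square bump_commute[of x j i])
    also have "\<dots> \<ge> 0"
      using g by (intro mult_nonneg_nonneg) (auto simp: symmetric_convex_in_def)
    finally show ?thesis by simp
  qed
  have "2 * a (m + 1) \<le> a m + a (m + 2)" if "m + 2 \<le> s + r" for m
  proof -
    define l where "l = s + r - m - 2"
    then have l: "s + r = l + m + 2"
      using that by simp
    let ?C = "\<lambda>h. expect J p l (expect J ?p' m h) (\<lambda>_. 0)"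
    have "2 * a (m + 1) = ?C (\<lambda>x. 2 * ?A (?B g) x)"
      by (simp add: a_def l expect_scale expect_next_customer_commute
          next_customer_commute[of J ?p' p])
    also have "\<dots> \<le> ?C (\<lambda>x. ?A (?A g) x + ?B (?B g) x)"
      using p p' second_difference by (intro expect_mono) auto
    also have "\<dots> = a m + a (m + 2)"
      by (simp add: a_def l expect_add expect_next_customer_commute
          next_customer_commute[of J ?p' p])
    finally show ?thesis .
  qed
  moreover have "a (s + r) = a 0"
    using expect_transpose[OF J(2,3), of p "s + r" g "\<lambda>_. 0"] g
    by (simp add: a_def symmetric_convex_in_def comp_def)
  ultimately have "a r \<le> a 0"
    by (intro convex_sequence_le_endpoint[of "s + r" a r]) auto
  then show ?thesis by (simp add: a_def)
qed

text \<open>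
  Schur convexity for a transfer between two options: a pair of probabilities with the same sum and
  no larger maximum is a mixture of \<open>(p i, p j)\<close> and \<open>(p j, p i)\<close>. Choosing according to the mixture
  means that each customer independently confuses \<open>i\<close> with \<open>j\<close> with some fixed probability \<open>c\<close>, and
  however many customers do, the expectation is not larger than without confusion.
\<close>
lemma expect_le_spread_apart:
  assumes J: "finite J" "i \<in> J" "j \<in> J" "i \<noteq> j"
    and p: "\<And>k. k \<in> J \<Longrightarrow> 0 \<le> p k"
    and other: "\<And>k. k \<noteq> i \<Longrightarrow> k \<noteq> j \<Longrightarrow> q k = p k"
    and total: "q i + q j = p i + p j"
    and le: "q i \<le> p i" "q j \<le> p i"
    and g: "symmetric_convex_in i j g"
  shows "expect J q T g (\<lambda>_. 0) \<le> expect J p T g (\<lambda>_. 0)"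
proof -
  define p' where "p' = p \<circ> exchange i j"
  obtain c where c: "0 \<le> c" "c \<le> 1" and q: "q = (\<lambda>k. (1 - c) * p k + c * p' k)"
  proof (cases "p i = p j")
    case True
    have "q = p"
    proof (intro ext)
      fix k
      have "q i = p i" "q j = p j" using True total le by linarith+
      then show "q k = p k" using other[of k] by blast
    qed
    then show ?thesis using that[of 0] by simp
  next
    case False
    define c where "c = (p i - q i) / (p i - p j)"
    have pos: "0 < p i - p j" using False total le by linarith
    have qi: "q i = (1 - c) * p i + c * p j"
    proof -
      have "c * (p i - p j) = p i - q i" using pos by (simp add: c_def)
      then show ?thesis by (simp add: algebra_simps)
    qed
    then have qj: "q j = (1 - c) * p j + c * p i"
      using total by (simp add: algebra_simps)
    have "q k = (1 - c) * p k + c * p' k" for k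
    proof -
      consider "k = i" | "k = j" | "k \<noteq> i" "k \<noteq> j" by blast
      then show ?thesis
      proof cases
        case 3
        then show ?thesis using other[OF 3] by (simp add: p'_def left_diff_distrib)
      qed (use qi qj in \<open>simp_all add: p'_def\<close>)
    qed
    then have "q = (\<lambda>k. (1 - c) * p k + c * p' k)" by blast
    moreover have "0 \<le> c" "c \<le> 1"
      using pos total le by (simp_all add: c_def)
    ultimately show ?thesis
      using that[of c] by blast
  qed
  have mix: "next_customer J q h
      = (\<lambda>x. (1 - c) * next_customer J p h x + c * next_customer J p' h x)" for h
    unfolding next_customer_def sum_distrib_left sum.distrib[symmetric] q
    by (simp only: distrib_right mult.assoc)
  \<comment> \<open>Of the customers, \<open>m\<close> are still undecided, \<open>s\<close> are not confused and \<open>r\<close> are.\<close>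
  have "expect J q m (expect J p s (expect J p' r g)) (\<lambda>_. 0) \<le> expect J p (m + s + r) g (\<lambda>_. 0)"
    for m s r
  proof (induction m arbitrary: s r)
    case 0
    show ?case
      unfolding expect.simps add_0 p'_def by (rule expect_some_transposed_le[OF J _ g]) (rule p)
  next
    case (Suc m)
    let ?F = "expect J p s (expect J p' r g)"
    have "expect J q (Suc m) ?F (\<lambda>_. 0)
        = (1 - c) * expect J q m (expect J p (Suc s) (expect J p' r g)) (\<lambda>_. 0)
          + c * expect J q m (expect J p s (expect J p' (Suc r) g)) (\<lambda>_. 0)"
    proof -
      have "next_customer J q ?F = (\<lambda>x. (1 - c) * expect J p (Suc s) (expect J p' r g) x
          + c * expect J p s (expect J p' (Suc r) g) x)"
        by (simp add: mix expect_next_customer_commute)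
      then show ?thesis
        by (simp only: expect_Suc_inner[of J q] expect_add expect_scale)
    qed
    also have "\<dots> \<le> (1 - c) * expect J p (Suc m + s + r) g (\<lambda>_. 0)
        + c * expect J p (Suc m + s + r) g (\<lambda>_. 0)"
      using Suc.IH[of "Suc s" r] Suc.IH[of s "Suc r"] c
      by (intro add_mono mult_left_mono) simp_all
    finally show ?case by (simp add: algebra_simps)
  qed
  from this[of T 0 0] show ?thesis by simp
qed

text \<open>
  Here \<open>u j\<close> is the capacity of option \<open>j\<close>. The options strictly between \<open>a\<close> and \<open>lo\<close> are full and
  those behind \<open>hi\<close> are empty. Moving as much as possible from \<open>hi\<close> to \<open>lo\<close> either empties \<open>hi\<close> or
  fills \<open>lo\<close>, and either way the gap between \<open>lo\<close> and \<open>hi\<close> shrinks. In both cases \<open>lo\<close> ends at least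
  as large as both were: it holds everything, or its capacity, which bounds both of them because
  capacities decrease.
\<close>
lemma expect_le_pour:
  fixes p u :: "nat \<Rightarrow> real"
  assumes "lo \<le> hi" and "a < lo" and "hi \<le> n"
    and "\<And>j. j \<in> {0..n} \<Longrightarrow> 0 \<le> p j"
    and "\<And>j. j \<in> {a<..n} \<Longrightarrow> p j \<le> u j"
    and anti: "\<And>i j. a < i \<Longrightarrow> i \<le> j \<Longrightarrow> j \<le> n \<Longrightarrow> u j \<le> u i"
    and "\<And>j. j \<in> {a<..<lo} \<Longrightarrow> p j = u j" and "\<And>j. j \<in> {hi<..n} \<Longrightarrow> p j = 0"
    and g: "\<And>i j. i \<in> {a<..n} \<Longrightarrow> j \<in> {a<..n} \<Longrightarrow> i \<noteq> j \<Longrightarrow> symmetric_convex_in i j g"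
  shows "\<exists>d q. d \<in> {a<..n} \<and> (\<forall>j\<in>{0..n}. 0 \<le> q j) \<and> sum q {0..n} = sum p {0..n} \<and>
     (\<forall>j\<le>a. q j = p j) \<and> (\<forall>j\<in>{a<..<d}. q j = u j) \<and> q d \<le> u d \<and> (\<forall>j\<in>{d<..n}. q j = 0) \<and>
     expect {0..n} p T g (\<lambda>_. 0) \<le> expect {0..n} q T g (\<lambda>_. 0)"
  using assms(1-5,7,8)
proof (induction "hi - lo" arbitrary: lo hi p)
  case 0
  then show ?case by (intro exI[of _ lo] exI[of _ p]) (simp_all add: order_antisym)
next
  case (Suc l)
  then have lohi: "lo < hi" by simp
  define \<delta> where "\<delta> = min (p hi) (u lo - p lo)"
  define p' where "p' = p(lo := p lo + \<delta>, hi := p hi - \<delta>)"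
  have \<delta>: "0 \<le> \<delta>" "\<delta> \<le> p hi" "\<delta> \<le> u lo - p lo"
    using Suc.prems lohi by (auto simp: \<delta>_def)
  have p'_nonneg: "0 \<le> p' j" if "j \<in> {0..n}" for j
    using Suc.prems(4)[of j] Suc.prems(4)[of lo] that \<delta> lohi Suc.prems by (auto simp: p'_def)
  have p'_le: "p' j \<le> u j" if "j \<in> {a<..n}" for j
    using Suc.prems(5)[of j] that \<delta> by (auto simp: p'_def)
  have phi: "p hi \<le> u lo"
  proof -
    have "p hi \<le> u hi" using Suc.prems(2,3,5) lohi by simp
    also have "u hi \<le> u lo" using Suc.prems(2,3) lohi by (intro anti) auto
    finally show ?thesis .
  qed
  have "expect {0..n} p T g (\<lambda>_. 0) \<le> expect {0..n} p' T g (\<lambda>_. 0)"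
  proof (rule expect_le_spread_apart[of _ lo hi])
    show "symmetric_convex_in lo hi g"
      using g Suc.prems lohi by auto
    show "p hi \<le> p' lo"
      using lohi phi Suc.prems(4)[of lo] Suc.prems by (auto simp: p'_def \<delta>_def min_def)
  qed (use Suc.prems lohi \<delta> p'_nonneg in \<open>auto simp: p'_def\<close>)
  moreover have "sum p' {0..n} = sum p {0..n}"
  proof -
    have split: "sum f {0..n} = f lo + f hi + sum f ({0..n} - {lo, hi})" for f :: "nat \<Rightarrow> real"
      using lohi Suc.prems by (subst sum.subset_diff[of "{lo, hi}"]) auto
    have "sum p' ({0..n} - {lo, hi}) = sum p ({0..n} - {lo, hi})"
      by (intro sum.cong) (auto simp: p'_def)
    then show ?thesis
      using lohi by (simp add: split) (simp add: p'_def)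
  qed
  moreover have "\<forall>j\<le>a. p' j = p j"
    using Suc.prems lohi by (auto simp: p'_def)
  moreover have "\<exists>lo' hi'. l = hi' - lo' \<and> lo' \<le> hi' \<and> a < lo' \<and> hi' \<le> n \<and>
      (\<forall>j\<in>{a<..<lo'}. p' j = u j) \<and> (\<forall>j\<in>{hi'<..n}. p' j = 0)"
  proof (cases "\<delta> = p hi")
    case True
    then show ?thesis
      using Suc.prems Suc.hyps(2) lohi
      by (intro exI[of _ lo] exI[of _ "hi - 1"]) (auto simp: p'_def)
  next
    case False
    then have "\<delta> = u lo - p lo" by (auto simp: \<delta>_def min_def split: if_splits)
    then show ?thesis
      using Suc.prems Suc.hyps(2) lohi
      by (intro exI[of _ "Suc lo"] exI[of _ hi]) (auto simp: p'_def less_Suc_eq)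
  qed
  then obtain lo' hi' where "l = hi' - lo'" "lo' \<le> hi'" "a < lo'" "hi' \<le> n"
    "\<And>j. j \<in> {a<..<lo'} \<Longrightarrow> p' j = u j" "\<And>j. j \<in> {hi'<..n} \<Longrightarrow> p' j = 0"
    by blast
  from Suc.hyps(1)[OF this(1-4) p'_nonneg p'_le this(5,6)]
  obtain d q where "d \<in> {a<..n}" "\<forall>j\<in>{0..n}. 0 \<le> q j" "sum q {0..n} = sum p' {0..n}"
     "\<forall>j\<le>a. q j = p' j" "\<forall>j\<in>{a<..<d}. q j = u j" "q d \<le> u d" "\<forall>j\<in>{d<..n}. q j = 0"
     "expect {0..n} p' T g (\<lambda>_. 0) \<le> expect {0..n} q T g (\<lambda>_. 0)"
    by blast
  ultimately show ?case
    by (intro exI[of _ d] exI[of _ q]) auto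
qed

section \<open>The maximum load\<close>

text \<open>Including \<open>0\<close> gives the empty set of products the maximum load \<open>0\<close>.\<close>
definition top_load :: "nat set \<Rightarrow> (nat \<Rightarrow> nat) \<Rightarrow> nat" where
  "top_load A x = Max (insert 0 (x ` A))"

lemma top_load_le_iff: "finite A \<Longrightarrow> top_load A x \<le> m \<longleftrightarrow> (\<forall>i\<in>A. x i \<le> m)"
  by (simp add: top_load_def)

lemma le_top_load: "finite A \<Longrightarrow> i \<in> A \<Longrightarrow> x i \<le> top_load A x"
  using top_load_le_iff by blast

lemma top_load_mono: "finite B \<Longrightarrow> A \<subseteq> B \<Longrightarrow> top_load A x \<le> top_load B x"
  by (subst top_load_le_iff) (auto intro: finite_subset le_top_load)

lemma top_load_insert: "finite A \<Longrightarrow> top_load (insert i A) x = max (x i) (top_load A x)"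
  unfolding top_load_def by (simp only: image_insert insert_commute[of 0 "x i"] Max_insert
      finite_insert finite_imageI insert_not_empty simp_thms)

lemma top_load_cong: "(\<And>i. i \<in> A \<Longrightarrow> x i = y i) \<Longrightarrow> top_load A x = top_load A y"
  by (simp add: top_load_def cong: image_cong)

lemma top_load_transpose: "top_load A (x \<circ> exchange i j) = top_load (exchange i j ` A) x"
  by (simp add: top_load_def image_comp)

lemma symmetric_convex_top_load:
  assumes "finite A" and "i \<in> A" and "j \<in> A" and "i \<noteq> j"
  shows "symmetric_convex_in i j (\<lambda>x. real (top_load A x))"
  unfolding symmetric_convex_in_def
proof (intro conjI allI)
  fix x
  show "real (top_load A (x \<circ> exchange i j)) = real (top_load A x)"
    using assms by (simp add: top_load_transpose)
  have A: "A = insert i (insert j (A - {i, j}))"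
    using assms by auto
  have top: "top_load A y = max (y i) (max (y j) (top_load (A - {i, j}) y))" for y
    using assms by (subst A) (simp add: top_load_insert)
  have rest: "top_load (A - {i, j}) (bump y k) = top_load (A - {i, j}) y" if "k \<in> {i, j}" for y k
    using that by (intro top_load_cong) (auto simp: bump_def)
  let ?i2 = "top_load A (bump (bump x i) i)" and ?j2 = "top_load A (bump (bump x j) j)"
  have "x i + 2 \<le> ?i2" "x j \<le> ?i2" "top_load (A - {i, j}) x \<le> ?i2"
    "x i \<le> ?j2" "x j + 2 \<le> ?j2" "top_load (A - {i, j}) x \<le> ?j2"
    using \<open>i \<noteq> j\<close> by (simp_all add: top rest le_max_iff_disj) (simp_all add: bump_def)
  moreover have "top_load A (bump (bump x i) j)
      = max (x i + 1) (max (x j + 1) (top_load (A - {i, j}) x))"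
    using \<open>i \<noteq> j\<close> by (simp add: top rest) (simp add: bump_def)
  ultimately have "2 * top_load A (bump (bump x i) j) \<le> ?i2 + ?j2"
    by (auto simp: max_def)
  then show "2 * real (top_load A (bump (bump x i) j)) \<le> real ?i2 + real ?j2"
    by linarith
qed

text \<open>
  Fix a product that attains the maximum. Ignoring any other product leaves the maximum as it is, and
  \<open>K\<close> contains at least \<open>k\<close> other products.
\<close>
lemma sum_top_load_remove_ge:
  assumes "finite A" and "K \<subseteq> A" and "card K = Suc k"
  shows "k * top_load A x \<le> (\<Sum>j\<in>K. top_load (A - {j}) x)"
proof -
  have "A \<noteq> {}" using assms by auto
  then obtain m where m: "m \<in> A" "top_load A x = x m"
  proof -
    have "Max (x ` A) \<in> x ` A" using \<open>A \<noteq> {}\<close> assms(1) by (intro Max_in) auto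
    then obtain m where "m \<in> A" "Max (x ` A) = x m" by (elim imageE)
    then show ?thesis
      using that[of m] \<open>A \<noteq> {}\<close> assms(1) by (simp add: top_load_def)
  qed
  have finK: "finite K" using assms finite_subset by blast
  have "k \<le> card (K - {m})"
    using assms(3) finK by (simp add: card_Diff_singleton_if)
  then have "k * top_load A x \<le> (\<Sum>j\<in>K - {m}. top_load A x)"
    by simp
  also have "\<dots> \<le> (\<Sum>j\<in>K - {m}. top_load (A - {j}) x)"
    using m assms(1) by (intro sum_mono) (auto intro!: le_top_load)
  also have "\<dots> \<le> (\<Sum>j\<in>K. top_load (A - {j}) x)"
    using finK by (intro sum_mono2) auto
  finally show ?thesis .
qed

lemma sum_mnl_prob:
  assumes "S \<subseteq> {1..n}" and "\<And>i. i \<in> {1..n} \<Longrightarrow> 0 < v i"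
  shows "sum (mnl_prob v S) {0..n} = 1"
proof -
  have pmf: "pmf (mnl_choice v S) = mnl_prob v S"
    using pmf_mnl_choice[OF assms] by auto
  have "set_pmf (mnl_choice v S) \<subseteq> {0..n}"
    using assms(1) by (auto simp: set_pmf_iff pmf mnl_prob_def split: if_splits)
  then have "sum (pmf (mnl_choice v S)) {0..n} = 1"
    by (intro sum_pmf_eq_1) auto
  then show ?thesis by (simp add: pmf)
qed

text \<open>
  The maximum may range over a larger set \<open>A\<close> of products, since products that are not offered have
  load \<open>0\<close>. This allows comparing different assortments through the same function of the loads.
\<close>
lemma expected_max_load_eq_expect:
  assumes S: "S \<subseteq> {1..n}" and v: "\<And>i. i \<in> {1..n} \<Longrightarrow> 0 < v i"
    and A: "S \<subseteq> A" "finite A" "0 \<notin> A"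
  shows "expected_max_load v T S
       = expect {0..n} (mnl_prob v S) T (\<lambda>x. real (top_load A x)) (\<lambda>_. 0)"
proof -
  have finS: "finite S" using A finite_subset by blast
  have max: "max_load T S w = top_load S (load T w)" for w
    using finS by (auto simp: max_load_def top_load_def)
  have pmf: "pmf (mnl_choice v S) = mnl_prob v S"
    using pmf_mnl_choice[OF S v] by auto
  have "set_pmf (mnl_choice v S) \<subseteq> {0..n}"
    using S by (auto simp: set_pmf_iff pmf mnl_prob_def split: if_splits)
  then have "expected_max_load v T S
       = expect {0..n} (mnl_prob v S) T (\<lambda>x. real (top_load S x)) (\<lambda>_. 0)"
    using expectation_load_eq_expect[of "{0..n}" "mnl_choice v S" T "\<lambda>x. real (top_load S x)"]
    by (simp add: expected_max_load_def customer_choices_def max pmf)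
  also have "\<dots> = expect {0..n} (mnl_prob v S) T (\<lambda>x. real (top_load A x)) (\<lambda>_. 0)"
  proof (rule expect_cong_support[of _ "insert 0 S"])
    fix x :: "nat \<Rightarrow> nat"
    assume x: "\<And>i. i \<notin> insert 0 S \<Longrightarrow> x i = 0"
    have "top_load A x \<le> top_load S x"
    proof (subst top_load_le_iff)
      show "\<forall>i\<in>A. x i \<le> top_load S x"
      proof
        fix i assume "i \<in> A"
        then show "x i \<le> top_load S x"
          using A(3) x[of i] le_top_load[OF finS, of i x] by (cases "i \<in> S"; cases "i = 0") auto
      qed
    qed (rule A)
    then show "real (top_load S x) = real (top_load A x)"
      using top_load_mono[OF A(2,1), of x] by simp
  qed (auto simp: mnl_prob_def)
  finally show ?thesis .
qed

section \<open>Block-based assortments\<close>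

lemma ex_smallest_elements:
  fixes S :: "nat set"
  assumes "finite S" and "k \<le> card S"
  obtains A where "A \<subseteq> S" and "card A = k" and "\<And>i j. i \<in> A \<Longrightarrow> j \<in> S - A \<Longrightarrow> i < j"
proof -
  let ?xs = "sorted_list_of_set S"
  have S: "set (take k ?xs) \<union> set (drop k ?xs) = S"
    using assms by (metis append_take_drop_id set_append set_sorted_list_of_set)
  have "sorted_wrt (<) (take k ?xs @ drop k ?xs)"
    by simp
  then have "\<And>i j. i \<in> set (take k ?xs) \<Longrightarrow> j \<in> set (drop k ?xs) \<Longrightarrow> i < j"
    unfolding sorted_wrt_append by blast
  moreover have "card (set (take k ?xs)) = k"
    using assms by (subst distinct_card) auto
  ultimately show ?thesis
    using that[of "set (take k ?xs)"] S by blast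
qed

text \<open>
  The prefix \<open>{Max S1 + 1..d - 1}\<close> and the remainder at \<open>d\<close> come from pouring the weight of \<open>R - S1\<close>
  towards small indices at constant total weight \<open>V\<close>. The factor \<open>k / (k + 1)\<close> is the price of
  dropping the remainder, which is no heavier than any of the \<open>k\<close> products in \<open>S1\<close>.
\<close>
lemma ex_prefix_assortment:
  assumes v: "\<And>i. i \<in> {1..n} \<Longrightarrow> 0 < v i"
    and anti: "\<And>i j. 1 \<le> i \<Longrightarrow> i \<le> j \<Longrightarrow> j \<le> n \<Longrightarrow> v j \<le> v i"
    and R: "R \<subseteq> {1..n}" and S1: "S1 \<subseteq> R" "card S1 = k" "0 < k" "k < card R"
    and first: "\<And>i j. i \<in> S1 \<Longrightarrow> j \<in> R - S1 \<Longrightarrow> i < j"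
  shows "\<exists>d\<in>{Max S1<..n}.
    real k * expected_max_load v T R
      \<le> (real k + 1) * expected_max_load v T (S1 \<union> {Max S1 + 1..d - 1})"
proof -
  define a where "a = Max S1"
  define I where "I = {1..n}"
  define top where "top A = (\<lambda>x. real (top_load A x))" for A
  let ?J = "{0..n}"
  have finR: "finite R" using R by (rule finite_subset) simp
  then have finS1: "finite S1" using S1(1) finite_subset by blast
  have S1_le: "i \<le> a" if "i \<in> S1" for i
    using that finS1 by (simp add: a_def)
  have aS1: "a \<in> S1"
    using S1 finS1 unfolding a_def by (intro Max_in) auto
  have R_le_a: "i \<in> S1" if "i \<in> R" "i \<le> a" for i
    using first[OF aS1, of i] that by auto
  have "R - S1 \<noteq> {}"
    using S1 finS1 card_mono[of S1 R] by auto
  then obtain i where i: "i \<in> R - S1" by blast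
  then have "i \<le> n" using R by auto
  then have an: "a < n" using first[OF aS1 i] by simp
  have v_nonneg: "0 \<le> v i" if "i \<in> {1..n}" for i
    using v[OF that] by simp
  define V where "V = 1 + sum v R"
  have V: "0 < V"
    unfolding V_def by (intro add_pos_nonneg sum_nonneg v_nonneg subsetD[OF R]) simp_all
  \<comment> \<open>The capacity of a product is its full weight, relative to the total weight of \<open>R\<close>.\<close>
  define u where "u i = v i / V" for i
  let ?p = "mnl_prob v R"
  have p: "?p i = (if i = 0 then 1 / V else if i \<in> R then u i else 0)" for i
    by (simp add: mnl_prob_def V_def u_def)
  have u: "0 < u i" if "i \<in> I" for i
    using v V that by (auto simp: u_def I_def)
  have u_anti: "u j \<le> u i" if "1 \<le> i" "i \<le> j" "j \<le> n" for i j
    using anti that V by (simp add: u_def divide_right_mono)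
  have "\<exists>d q. d \<in> {a<..n} \<and> (\<forall>j\<in>?J. 0 \<le> q j) \<and> sum q ?J = sum ?p ?J \<and>
     (\<forall>j\<le>a. q j = ?p j) \<and> (\<forall>j\<in>{a<..<d}. q j = u j) \<and> q d \<le> u d \<and> (\<forall>j\<in>{d<..n}. q j = 0) \<and>
     expect ?J ?p T (top I) (\<lambda>_. 0) \<le> expect ?J q T (top I) (\<lambda>_. 0)"
  proof (rule expect_le_pour[of "a + 1" n])
    show "0 \<le> ?p j" if "j \<in> ?J" for j
      using u[of j] V R by (auto simp: p I_def)
    show "?p j \<le> u j" if "j \<in> {a<..n}" for j
      using u[of j] that by (auto simp: p I_def)
    show "u j \<le> u i" if "a < i" "i \<le> j" "j \<le> n" for i j
      using u_anti that by simp
    show "symmetric_convex_in i j (top I)" if "i \<in> {a<..n}" "j \<in> {a<..n}" "i \<noteq> j" for i j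
      unfolding top_def using that by (intro symmetric_convex_top_load) (auto simp: I_def)
  qed (use an in auto)
  then obtain d q where d: "d \<in> {a<..n}" and q_nonneg: "\<And>j. j \<in> ?J \<Longrightarrow> 0 \<le> q j"
    and q_total: "sum q ?J = sum ?p ?J"
    and q_low: "\<And>j. j \<le> a \<Longrightarrow> q j = ?p j" and q_mid: "\<And>j. j \<in> {a<..<d} \<Longrightarrow> q j = u j"
    and q_d: "q d \<le> u d" and q_high: "\<And>j. j \<in> {d<..n} \<Longrightarrow> q j = 0"
    and poured: "expect ?J ?p T (top I) (\<lambda>_. 0) \<le> expect ?J q T (top I) (\<lambda>_. 0)"
    by blast
  define S where "S = S1 \<union> {a + 1..d - 1}"
  have S: "S \<subseteq> {1..n}" and dS: "d \<notin> S"
    using S1 R d S1_le by (fastforce simp: S_def)+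
  have finS: "finite S" using S finite_subset by blast
  have S0: "0 \<notin> S" using S by auto
  have q: "q j = (if j = 0 then 1 / V else if j \<in> S then u j else 0)" if "j \<in> ?J" "j \<noteq> d" for j
    using that q_low[of j] q_mid[of j] q_high[of j] R_le_a[of j] S1 S1_le[of j] S0
    by (auto simp: p S_def not_less_eq_eq Suc_le_eq)
  have q_S: "q x = u x" if "x \<in> S" for x
  proof -
    have "x \<in> {1..n}" "x \<noteq> d" using that S dS by blast+
    then show ?thesis using q[of x] that by simp
  qed
  have "1 = sum q ?J"
    using q_total sum_mnl_prob[OF R v] by simp
  also have "\<dots> = q d + sum q (?J - {d})"
    using d by (subst sum.remove[of _ d]) auto
  also have "sum q (?J - {d}) = sum q (insert 0 S)"
    using S d dS q by (intro sum.mono_neutral_right) auto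
  also have "\<dots> = 1 / V + sum u S"
    using d q[of 0] q_S S0 finS by simp
  also have "sum u S = sum v S / V"
    by (simp add: u_def sum_divide_distrib)
  \<comment> \<open>Dropping \<open>d\<close> decreases the total weight, so all remaining options gain probability.\<close>
  finally have VS: "1 + sum v S = V * (1 - q d)"
    using V by (simp add: field_simps)
  have VS_pos: "0 < 1 + sum v S"
    by (intro add_pos_nonneg sum_nonneg v_nonneg subsetD[OF S]) simp_all
  have VS_le: "1 + sum v S \<le> V"
    using VS q_nonneg[of d] d V by (simp add: mult_le_cancel_left)
  let ?p' = "mnl_prob v S"
  have p': "?p' j \<ge> q j" if "j \<in> ?J" "j \<noteq> d" for j
    using that q VS_le VS_pos v S by (auto simp: mnl_prob_def u_def less_imp_le intro!: divide_left_mono)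
  have p'_nonneg: "0 \<le> ?p' j" for j
    using VS_pos v S by (auto simp: mnl_prob_def less_imp_le)
  let ?f = "expect ?J ?p' T (top (I - {d})) (\<lambda>_. 0)"
  define K where "K = insert d S1"
  \<comment> \<open>Ignoring \<open>j\<close> is the same as ignoring \<open>d\<close> after the two have exchanged their probabilities.
    After the exchange \<open>j\<close> has only the smaller probability \<open>q d\<close>, and removing \<open>d\<close> shifts mass from
    an ignored option to the others.\<close>
  have drop: "expect ?J q T (top (I - {j})) (\<lambda>_. 0) \<le> ?f" if "j \<in> K" for j
  proof -
    let ?\<tau> = "exchange d j"
    have j: "j \<in> I" using that d S1 R by (auto simp: K_def I_def)
    have dI: "d \<in> I" using d by (auto simp: I_def)
    have qdj: "q d \<le> q j"
    proof (cases "j = d")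
      case False
      then have "j \<in> S1" using that by (simp add: K_def)
      then have "u d \<le> q j" "j \<le> d"
        using q[of j] False j S1_le[of j] d u_anti[of j d] by (auto simp: S_def I_def)
      then show ?thesis using q_d by simp
    qed simp
    have "expect ?J (q \<circ> ?\<tau>) T (top (I - {d})) (\<lambda>_. 0) = expect ?J q T (top (I - {j})) (\<lambda>_. 0)"
    proof -
      have "?\<tau> ` (I - {d}) = I - {j}"
        using j dI by (simp add: image_set_diff)
      moreover have "(\<lambda>_. 0 :: nat) \<circ> ?\<tau> = (\<lambda>_. 0)"
        by auto
      ultimately show ?thesis
        using j dI expect_transpose[of d ?J j q T "top (I - {d})" "\<lambda>_. 0"]
        by (simp add: top_def top_load_transpose) (simp add: I_def)
    qed
    moreover have "expect ?J (q \<circ> ?\<tau>) T (top (I - {d})) (\<lambda>_. 0) \<le> ?f"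
    proof (rule expect_le_shift_from[where d = d])
      have "sum (q \<circ> ?\<tau>) ?J = sum q ?J"
        using j dI by (intro sum.reindex_bij_betw[of ?\<tau> ?J ?J q, simplified comp_def[symmetric]])
          (auto simp: bij_betw_transpose_iff I_def)
      then show "sum (q \<circ> ?\<tau>) ?J = sum ?p' ?J"
        using q_total sum_mnl_prob[OF R v] sum_mnl_prob[OF S v] by simp
      show "(q \<circ> ?\<tau>) i \<le> ?p' i" if "i \<in> ?J" "i \<noteq> d" for i
        using p'[OF that] qdj that by (auto simp: Transposition.transpose_def)
      show "0 \<le> (q \<circ> ?\<tau>) i" if "i \<in> ?J" for i
        using q_nonneg that j dI by (auto simp: Transposition.transpose_def I_def)
      show "top (I - {d}) (bump x d) \<le> top (I - {d}) (bump x i)" for i x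
        unfolding top_def of_nat_le_iff
        by (subst top_load_le_iff) (auto simp: I_def bump_def intro!: order.trans[OF _ le_top_load])
    qed (use p'_nonneg in simp)
    ultimately show ?thesis by simp
  qed
  have dS1: "d \<notin> S1" using dS by (simp add: S_def)
  have KI: "K \<subseteq> I" and cardK: "card K = Suc k"
    using d S1 R finS1 dS1 by (auto simp: K_def I_def)
  have finK: "finite K" using finS1 by (simp add: K_def)
  have "real k * expected_max_load v T R = real k * expect ?J ?p T (top I) (\<lambda>_. 0)"
    unfolding top_def using R v
    by (subst expected_max_load_eq_expect[where A = I and n = n]) (auto simp: I_def)
  also have "\<dots> \<le> real k * expect ?J q T (top I) (\<lambda>_. 0)"
    using poured by (intro mult_left_mono) auto
  also have "\<dots> = expect ?J q T (\<lambda>x. real k * top I x) (\<lambda>_. 0)"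
    by (simp add: expect_scale)
  also have "\<dots> \<le> expect ?J q T (\<lambda>x. \<Sum>j\<in>K. top (I - {j}) x) (\<lambda>_. 0)"
  proof (rule expect_mono[OF q_nonneg])
    fix x
    have "k * top_load I x \<le> (\<Sum>j\<in>K. top_load (I - {j}) x)"
      using KI cardK by (intro sum_top_load_remove_ge) (auto simp: I_def)
    then have "real (k * top_load I x) \<le> real (\<Sum>j\<in>K. top_load (I - {j}) x)"
      by (rule of_nat_mono)
    then show "real k * top I x \<le> (\<Sum>j\<in>K. top (I - {j}) x)"
      by (simp add: top_def)
  qed
  also have "\<dots> = (\<Sum>j\<in>K. expect ?J q T (top (I - {j})) (\<lambda>_. 0))"
    using finK by (simp add: expect_sum)
  also have "\<dots> \<le> (\<Sum>j\<in>K. ?f)"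
    using drop by (intro sum_mono)
  also have "\<dots> = (real k + 1) * ?f"
    using cardK by simp
  also have "?f = expected_max_load v T S"
    unfolding top_def using S v dS
    by (subst expected_max_load_eq_expect[where A = "I - {d}" and n = n]) (auto simp: I_def)
  finally show ?thesis
    using d by (auto simp: S_def a_def)
qed

theorem theorem3p11:
  fixes \<epsilon> :: real and n T :: nat and v :: "nat \<Rightarrow> real" and S_opt :: "nat set"
  assumes "0 < \<epsilon>" and "\<epsilon> < 1" and "1 / \<epsilon> \<in> \<int>"
    and "\<forall>i\<in>{1..n}. 0 < v i"
    and "\<forall>i\<in>{1..n}. \<forall>j\<in>{1..n}. i \<le> j \<longrightarrow> v j \<le> v i"
    and "1 \<le> T"
    and "S_opt \<subseteq> {1..n}"
    and "expected_max_load v T S_opt = Max (expected_max_load v T ` Pow {1..n})"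
  shows "\<exists>S. S \<subseteq> {1..n} \<and> block_based \<epsilon> n v S \<and>
             (1 - \<epsilon>) * expected_max_load v T S_opt \<le> expected_max_load v T S"
proof -
  let ?f = "expected_max_load v T"
  have nonneg: "0 \<le> ?f S" for S
    by (simp add: expected_max_load_def)
  obtain k where k: "1 / \<epsilon> = real k"
    using assms(1,3) by (metis Ints_cases less_imp_le of_int_of_nat_eq zero_le_divide_1_iff
        zero_le_imp_eq_int of_int_0_le_iff)
  have "0 < k"
    using k assms(1) by (metis gr0I of_nat_0 zero_less_divide_1_iff less_irrefl)
  show ?thesis
  proof (cases "card S_opt \<le> k")
    case True
    then have "block_based \<epsilon> n v S_opt"
      using assms(7) by (simp add: block_based_def k)
    moreover have "(1 - \<epsilon>) * ?f S_opt \<le> 1 * ?f S_opt"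
      using assms(1) nonneg by (intro mult_right_mono) auto
    ultimately show ?thesis
      using assms(7) by auto
  next
    case False
    have "finite S_opt" using assms(7) finite_subset by blast
    with False obtain S1 where S1: "S1 \<subseteq> S_opt" "card S1 = k"
      "\<And>i j. i \<in> S1 \<Longrightarrow> j \<in> S_opt - S1 \<Longrightarrow> i < j"
      using ex_smallest_elements[of S_opt k] by (metis nat_le_linear)
    obtain d where d: "d \<in> {Max S1<..n}"
      and le: "real k * ?f S_opt \<le> (real k + 1) * ?f (S1 \<union> {Max S1 + 1..d - 1})"
      using ex_prefix_assortment[of n v S_opt S1 k T] assms(4,5,7) S1 \<open>0 < k\<close> False by force
    define S where "S = S1 \<union> {Max S1 + 1..d - 1}"
    have S: "S \<subseteq> {1..n}"
      using S1 assms(7) d by (fastforce simp: S_def)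
    have "block_based \<epsilon> n v S"
      unfolding block_based_def
    proof (intro conjI disjI2 exI)
      show "S = S1 \<union> {Max S1 + 1..d - 1} \<union> {}" by (simp add: S_def)
      show "if d - 1 = n then {} = {} else \<exists>N. (\<forall>l\<in>{1..num_classes \<epsilon>}. N l
          \<le> card (weight_class \<epsilon> n v (d - 1 + 1) l)) \<and>
        {} = (\<Union>l\<in>{1..num_classes \<epsilon>}. largest (N l) (weight_class \<epsilon> n v (d - 1 + 1) l))"
        by (auto simp: largest_def intro!: exI[of _ "\<lambda>_. 0"])
    qed (use S S1 assms(7) d k in auto)
    moreover have "(1 - \<epsilon>) * ?f S_opt \<le> ?f S"
    proof -
      have \<epsilon>: "\<epsilon> = 1 / real k" by (simp flip: k)
      have "(1 - \<epsilon>) * (real k + 1) \<le> real k"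
        using \<open>0 < k\<close> by (simp add: \<epsilon> field_simps)
      then have "((1 - \<epsilon>) * (real k + 1)) * ?f S_opt \<le> real k * ?f S_opt"
        using nonneg by (rule mult_right_mono)
      with le have "(real k + 1) * ((1 - \<epsilon>) * ?f S_opt) \<le> (real k + 1) * ?f S"
        unfolding S_def by (simp only: mult_ac)
      then show ?thesis
        by (rule mult_left_le_imp_le) simp
    qed
    ultimately show ?thesis using S by blast
  qed
qed

end
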